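(* Let $r,s,t$ be integers with $0\le r,s<t$ and $\gcd(r,s,t)=1$, let $\alpha>1$ be the unique real number $>1$ with $\alpha^{t^2}=\alpha^{r^2}+\alpha^{s^2}$, and let $$D(x,y,z)=1+z^2-z\alpha^{r^2-t^2}\Bigl(x+\frac1x\Bigr)-z\alpha^{s^2-t^2}\Bigl(y+\frac1y\Bigr).$$ For all triples $(i_0,j_0,k_0)\in\mathbb Z^3$ with $i_0+j_0+k_0$ even and $p:=ri_0+sj_0+tk_0\in[0,2t-1]$, the density generating function of the uniform $(r,s,t)$-slanted solution satisfies $$\rho^{(i_0,j_0,k_0)}(x,y,z)=x^{i_0}y^{j_0}z^{k_0}\,\rho_p(x,y,z),$$ where, for $r\le s<t$, $$\rho_p(x,y,z)=\frac{1}{D(x,y,z)}\begin{cases}1-z\alpha^{r^2-t^2}\bigl(x+\frac1x\bigr)-z\alpha^{s^2-t^2}\bigl(y+\frac1y\bigr)&(0\le p<t-s)\\ 1-z\alpha^{r^2-t^2}\bigl(x+\frac1x\bigr)-z\alpha^{s^2-t^2}\frac1y&(t-s\le p<t-r)\\ 1-z\alpha^{r^2-t^2}\frac1x-z\alpha^{s^2-t^2}\frac1y&(t-r\le p<t+r)\\ 1-z\alpha^{s^2-t^2}\frac1y&(t+r\le p<t+s)\\ 1&(t+s\le p<2t)\end{cases}$$ and, for $s\le r<t$, $$\rho_p(x,y,z)=\frac{1}{D(x,y,z)}\begin{cases}1-z\alpha^{r^2-t^2}\bigl(x+\frac1x\bigr)-z\alpha^{s^2-t^2}\bigl(y+\frac1y\bigr)&(0\le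 p<t-r)\\ 1-z\alpha^{r^2-t^2}\frac1x-z\alpha^{s^2-t^2}\bigl(y+\frac1y\bigr)&(t-r\le p<t-s)\\ 1-z\alpha^{r^2-t^2}\frac1x-z\alpha^{s^2-t^2}\frac1y&(t-s\le p<t+s)\\ 1-z\alpha^{r^2-t^2}\frac1x&(t+s\le p<t+r)\\ 1&(t+r\le p<2t).\end{cases}$$
   Context: All lattice points $(i,j,k)\in\mathbb Z^3$ considered satisfy $i+j+k\equiv 0 \pmod 2$. Write $\mu(i,j,k)=ri+sj+tk$. The $T$-system is $T_{i,j,k+1}T_{i,j,k-1}=T_{i+1,j,k}T_{i-1,j,k}+T_{i,j+1,k}T_{i,j-1,k}$. $(r,s,t)$-slanted initial data consist of positive values $t_{i_0,j_0}=T_{i_0,j_0,k_0}$ at all points $(i_0,j_0,k_0)$ with $0\le \mu(i_0,j_0,k_0)\le 2t-1$ (for each $(i_0,j_0)$ there is exactly one such $k_0$ of the right parity); they determine $T_{i,j,k}$ at all points with $\mu(i,j,k)\ge0$. The uniform solution is obtained from the initial data $T_{i,j,k}=\alpha^{m(m-1)/2}$ with $m=\mu(i,j,k)$, $0\le m\le 2t-1$, and then $T_{i,j,k}=\alpha^{m(m-1)/2}$ for all $m=\mu(i,j,k)\ge0$. The local dimer density is the logarithmic derivative $\rho^{(i_0,j_0,k_0)}_{i,j,k}=\frac{t_{i_0,j_0}}{T_{i,j,k}}\frac{\partial T_{i,j,k}}{\partial t_{i_0,j_0}}$, evaluated at the uniform initial data. Equivalently, it equals $\delta_{i,i_0}\delta_{j,j_0}\delta_{k,k_0}$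 at points with $0\le\mu(i,j,k)\le2t-1$, and satisfies $\rho_{i,j,k+1}+\rho_{i,j,k-1}=\alpha^{r^2-t^2}(\rho_{i+1,j,k}+\rho_{i-1,j,k})+\alpha^{s^2-t^2}(\rho_{i,j+1,k}+\rho_{i,j-1,k})$ whenever $\mu(i,j,k+1)\ge 2t$. The generating function is $\rho^{(i_0,j_0,k_0)}(x,y,z)=\sum_{\mu(i,j,k)\ge0}\rho^{(i_0,j_0,k_0)}_{i,j,k}x^iy^jz^k$, and $1/D$ is expanded as a formal power series in $z$ with coefficients Laurent polynomials in $x,y$. *)

theory Defs
  imports
    "HOL-Analysis.Analysis"
    "HOL-Library.Poly_Mapping"
    "HOL-Library.Product_Plus"
    "HOL-Computational_Algebra.Formal_Laurent_Series"
begin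

section \<open>Slanted initial data and the solution of the T-system\<close>

definition mu :: "int \<Rightarrow> int \<Rightarrow> int \<Rightarrow> int \<Rightarrow> int \<Rightarrow> int \<Rightarrow> int" where
  "mu r s t i j k = r * i + s * j + t * k"

text \<open>
  Lattice points are the \<open>(i,j,k)\<close> with \<open>even (i + j + k)\<close>; the T-system relates the six lattice
  neighbours of a centre \<open>(i,j,k)\<close> with \<open>odd (i + j + k)\<close>. The values of \<open>T\<close> at non-lattice points and
  at points with \<open>mu < 0\<close> are irrelevant.
\<close>

definition T_solution ::
  "int \<Rightarrow> int \<Rightarrow> int \<Rightarrow> (int \<Rightarrow> int \<Rightarrow> real) \<Rightarrow> (int \<Rightarrow> int \<Rightarrow> int \<Rightarrow> real) \<Rightarrow> bool" where
  "T_solution r s t \<tau> T \<longleftrightarrow>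
     (\<forall>i j k. even (i + j + k) \<and> mu r s t i j k \<in> {0..2*t - 1} \<longrightarrow> T i j k = \<tau> i j) \<and>
     (\<forall>i j k. odd (i + j + k) \<and> 0 \<le> mu r s t i j (k - 1) \<longrightarrow>
        T i j (k + 1) * T i j (k - 1) = T (i + 1) j k * T (i - 1) j k + T i (j + 1) k * T i (j - 1) k)"

text \<open>
  The solution as a function of the initial data \<open>\<tau>\<close>, by solving the T-system for \<open>T i j (k + 1)\<close>.
  The conditions on the absolute values of \<open>r\<close> and \<open>s\<close> only serve termination.
  \<open>slanted_T_solution\<close> and \<open>T_solution_unique\<close> below show that this is the solution.
\<close>

function slanted_T ::
  "int \<Rightarrow> int \<Rightarrow> int \<Rightarrow> (int \<Rightarrow> int \<Rightarrow> real) \<Rightarrow> int \<Rightarrow> int \<Rightarrow> int \<Rightarrow> real" where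
  "slanted_T r s t \<tau> i j k =
     (if \<bar>r\<bar> < t \<and> \<bar>s\<bar> < t \<and> 2 * t \<le> mu r s t i j k
      then (slanted_T r s t \<tau> (i + 1) j (k - 1) * slanted_T r s t \<tau> (i - 1) j (k - 1)
            + slanted_T r s t \<tau> i (j + 1) (k - 1) * slanted_T r s t \<tau> i (j - 1) (k - 1))
           / slanted_T r s t \<tau> i j (k - 2)
      else \<tau> i j)"
  by pat_completeness auto
termination
  by (relation "Wellfounded.measure (\<lambda>(r, s, t, \<tau>, i, j, k). nat (mu r s t i j k))")
     (auto simp: mu_def algebra_simps)

declare slanted_T.simps [simp del]

lemma slanted_T_pos:
  assumes "\<And>i j. \<tau> i j > 0"
  shows "slanted_T r s t \<tau> i j k > 0"
  using assms
proof (induction r s t \<tau> i j k rule: slanted_T.induct)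
  case (1 r s t \<tau> i j k)
  show ?case
    by (subst slanted_T.simps) (auto intro!: divide_pos_pos add_pos_pos mult_pos_pos 1)
qed

lemma slanted_T_solution:
  assumes "0 \<le> r" "r < t" "0 \<le> s" "s < t" and pos: "\<And>i j. \<tau> i j > 0"
  shows "T_solution r s t \<tau> (slanted_T r s t \<tau>)"
  unfolding T_solution_def
proof (intro conjI allI impI)
  fix i j k
  assume "even (i + j + k) \<and> mu r s t i j k \<in> {0..2*t - 1}"
  thus "slanted_T r s t \<tau> i j k = \<tau> i j"
    by (subst slanted_T.simps) auto
next
  fix i j k
  assume "odd (i + j + k) \<and> 0 \<le> mu r s t i j (k - 1)"
  hence le: "2 * t \<le> mu r s t i j (k + 1)"
    by (simp add: mu_def algebra_simps)
  have ne: "slanted_T r s t \<tau> i j (k - 1) \<noteq> 0"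
    using slanted_T_pos[of \<tau> r s t i j "k - 1"] pos by simp
  show "slanted_T r s t \<tau> i j (k + 1) * slanted_T r s t \<tau> i j (k - 1) =
        slanted_T r s t \<tau> (i + 1) j k * slanted_T r s t \<tau> (i - 1) j k +
        slanted_T r s t \<tau> i (j + 1) k * slanted_T r s t \<tau> i (j - 1) k"
    using le assms(1-4) ne by (subst slanted_T.simps) simp
qed

lemma T_solution_unique:
  assumes rst: "0 \<le> r" "r < t" "0 \<le> s" "s < t" and pos: "\<And>i j. \<tau> i j > 0"
    and sol: "T_solution r s t \<tau> T"
    and "even (i + j + k)" "0 \<le> mu r s t i j k"
  shows "T i j k = slanted_T r s t \<tau> i j k"
  using assms(7,8)
proof (induction "nat (mu r s t i j k)" arbitrary: i j k rule: less_induct)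
  case less
  show ?case
  proof (cases "mu r s t i j k < 2 * t")
    case True
    hence "T i j k = \<tau> i j"
      using sol less.prems by (auto simp: T_solution_def)
    with True show ?thesis by (subst slanted_T.simps) simp
  next
    case False
    have eqs: "mu r s t (i + 1) j (k - 1) = mu r s t i j k - t + r"
      "mu r s t (i - 1) j (k - 1) = mu r s t i j k - t - r"
      "mu r s t i (j + 1) (k - 1) = mu r s t i j k - t + s"
      "mu r s t i (j - 1) (k - 1) = mu r s t i j k - t - s"
      "mu r s t i j (k - 2) = mu r s t i j k - 2 * t"
      by (simp_all add: mu_def algebra_simps)
    have IH: "T (i + 1) j (k - 1) = slanted_T r s t \<tau> (i + 1) j (k - 1)"
      "T (i - 1) j (k - 1) = slanted_T r s t \<tau> (i - 1) j (k - 1)"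
      "T i (j + 1) (k - 1) = slanted_T r s t \<tau> i (j + 1) (k - 1)"
      "T i (j - 1) (k - 1) = slanted_T r s t \<tau> i (j - 1) (k - 1)"
      "T i j (k - 2) = slanted_T r s t \<tau> i j (k - 2)"
      using rst False less.prems by (auto intro!: less.hyps simp: eqs)
    have "odd (i + j + (k - 1)) \<and> 0 \<le> mu r s t i j (k - 1 - 1)"
      using less.prems False eqs(5) by simp
    hence "T i j (k - 1 + 1) * T i j (k - 1 - 1) =
        T (i + 1) j (k - 1) * T (i - 1) j (k - 1) + T i (j + 1) (k - 1) * T i (j - 1) (k - 1)"
      using sol unfolding T_solution_def by blast
    hence "T i j k * T i j (k - 2) =
        T (i + 1) j (k - 1) * T (i - 1) j (k - 1) + T i (j + 1) (k - 1) * T i (j - 1) (k - 1)"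
      by simp
    moreover have "slanted_T r s t \<tau> i j (k - 2) \<noteq> 0"
      using slanted_T_pos[of \<tau> r s t i j "k - 2"] pos by simp
    ultimately have "T i j k =
        (slanted_T r s t \<tau> (i + 1) j (k - 1) * slanted_T r s t \<tau> (i - 1) j (k - 1)
            + slanted_T r s t \<tau> i (j + 1) (k - 1) * slanted_T r s t \<tau> i (j - 1) (k - 1))
           / slanted_T r s t \<tau> i j (k - 2)"
      by (simp add: IH nonzero_eq_divide_eq)
    thus ?thesis using rst False by (subst slanted_T.simps) simp
  qed
qed

section \<open>The uniform solution and the local dimer density\<close>

text \<open>The third coordinate of the unique initial lattice point above \<open>(i,j)\<close>.\<close>

definition init_height :: "int \<Rightarrow> int \<Rightarrow> int \<Rightarrow> int \<Rightarrow> int \<Rightarrow> int" where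
  "init_height r s t i j = (THE k. even (i + j + k) \<and> mu r s t i j k \<in> {0..2*t - 1})"

lemma ex1_init_height:
  assumes "0 < t"
  shows "\<exists>!k. even (i + j + k) \<and> mu r s t i j k \<in> {0..2*t - 1}"
proof -
  define c where "c = mu r s t i j (i + j)"
  have mu_eq: "mu r s t i j (i + j + 2 * n) = c + 2 * t * n" for n
    by (simp add: c_def mu_def algebra_simps)
  show ?thesis
  proof (rule ex1I[of _ "i + j + 2 * (- (c div (2 * t)))"])
    have "mu r s t i j (i + j + 2 * (- (c div (2 * t)))) = c mod (2 * t)"
      unfolding mu_eq by (simp add: minus_mult_div_eq_mod)
    thus "even (i + j + (i + j + 2 * (- (c div (2 * t))))) \<and>
          mu r s t i j (i + j + 2 * (- (c div (2 * t)))) \<in> {0..2*t - 1}"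
      using assms pos_mod_bound[of "2 * t" c] by simp
  next
    fix k assume k: "even (i + j + k) \<and> mu r s t i j k \<in> {0..2*t - 1}"
    hence "even (k - (i + j))" by presburger
    then obtain n where "k - (i + j) = 2 * n" by (rule evenE)
    hence n: "k = i + j + 2 * n" by simp
    have b: "0 \<le> c + 2 * t * n" "c + 2 * t * n < 2 * t"
      using k unfolding n mu_eq by auto
    have "c div (2 * t) = - n"
    proof -
      have "c = 2 * t * (- n) + (c + 2 * t * n)" by simp
      thus ?thesis using b by (metis int_div_pos_eq)
    qed
    thus "k = i + j + 2 * (- (c div (2 * t)))" by (simp add: n)
  qed
qed

text \<open>The division by 2 in the exponent is exact.\<close>

definition uniform_data :: "int \<Rightarrow> int \<Rightarrow> int \<Rightarrow> real \<Rightarrow> int \<Rightarrow> int \<Rightarrow> real" where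
  "uniform_data r s t \<alpha> i j =
     (let m = mu r s t i j (init_height r s t i j) in \<alpha> powi (m * (m - 1) div 2))"

text \<open>
  Logarithmic derivative of \<open>T i j k\<close> with respect to the initial value \<open>\<tau> i\<^sub>0 j\<^sub>0\<close>, all other
  initial values being kept fixed.
\<close>

definition log_deriv_T ::
  "int \<Rightarrow> int \<Rightarrow> int \<Rightarrow> (int \<Rightarrow> int \<Rightarrow> real) \<Rightarrow> int \<Rightarrow> int \<Rightarrow> int \<Rightarrow> int \<Rightarrow> int \<Rightarrow> real" where
  "log_deriv_T r s t \<tau> i\<^sub>0 j\<^sub>0 i j k =
     \<tau> i\<^sub>0 j\<^sub>0 / slanted_T r s t \<tau> i j k *
     deriv (\<lambda>u. slanted_T r s t (\<tau>(i\<^sub>0 := (\<tau> i\<^sub>0)(j\<^sub>0 := u))) i j k) (\<tau> i\<^sub>0 j\<^sub>0)"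

text \<open>
  The density depends on the initial point \<open>(i\<^sub>0,j\<^sub>0,k\<^sub>0)\<close> only through \<open>(i\<^sub>0,j\<^sub>0)\<close>, which
  determines \<open>k\<^sub>0\<close>.
\<close>

definition density ::
  "int \<Rightarrow> int \<Rightarrow> int \<Rightarrow> real \<Rightarrow> int \<Rightarrow> int \<Rightarrow> int \<Rightarrow> int \<Rightarrow> int \<Rightarrow> real" where
  "density r s t \<alpha> i\<^sub>0 j\<^sub>0 i j k = log_deriv_T r s t (uniform_data r s t \<alpha>) i\<^sub>0 j\<^sub>0 i j k"

section \<open>Formal series\<close>

text \<open>
  A formal series in \<open>x\<^sup>\<plusminus>\<close>, \<open>y\<^sup>\<plusminus>\<close>, \<open>z\<^sup>\<plusminus>\<close> is given by its family of coefficients, with no a priori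
  restriction on the support. The generating function sums over lattice points with \<open>mu \<ge> 0\<close>.
\<close>

definition density_gf ::
  "int \<Rightarrow> int \<Rightarrow> int \<Rightarrow> real \<Rightarrow> int \<Rightarrow> int \<Rightarrow> (int \<Rightarrow> int \<Rightarrow> int \<Rightarrow> real)" where
  "density_gf r s t \<alpha> i\<^sub>0 j\<^sub>0 = (\<lambda>i j k.
     if even (i + j + k) \<and> 0 \<le> mu r s t i j k then density r s t \<alpha> i\<^sub>0 j\<^sub>0 i j k else 0)"

text \<open>Laurent polynomials in \<open>x\<close>, \<open>y\<close>, as finitely supported functions of the exponents.\<close>

type_synonym laurent = "(int \<times> int) \<Rightarrow>\<^sub>0 real"

definition lmonom :: "int \<Rightarrow> int \<Rightarrow> laurent" where
  "lmonom a b = Poly_Mapping.single (a, b) 1"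

definition lconst :: "real \<Rightarrow> laurent" where
  "lconst c = Poly_Mapping.single (0, 0) c"

definition series_coeffs :: "laurent fls \<Rightarrow> (int \<Rightarrow> int \<Rightarrow> int \<Rightarrow> real)" where
  "series_coeffs F = (\<lambda>i j k. Poly_Mapping.lookup (fls_nth F k) (i, j))"

definition monomial3 :: "int \<Rightarrow> int \<Rightarrow> int \<Rightarrow> laurent fls" where
  "monomial3 a b c = fls_const (lmonom a b) * fls_X_intpow c"

abbreviation varX :: laurent where "varX \<equiv> lmonom 1 0"
abbreviation varX_inv :: laurent where "varX_inv \<equiv> lmonom (- 1) 0"
abbreviation varY :: laurent where "varY \<equiv> lmonom 0 1"
abbreviation varY_inv :: laurent where "varY_inv \<equiv> lmonom 0 (- 1)"

text \<open>\<open>zterm \<alpha> e p\<close> is the term \<open>z \<alpha>\<^sup>e p(x,y)\<close>.\<close>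

definition zterm :: "real \<Rightarrow> int \<Rightarrow> laurent \<Rightarrow> laurent fps" where
  "zterm \<alpha> e p = fps_X * fps_const (lconst (\<alpha> powi e) * p)"

definition denomD :: "int \<Rightarrow> int \<Rightarrow> int \<Rightarrow> real \<Rightarrow> laurent fps" where
  "denomD r s t \<alpha> =
     1 + fps_X ^ 2 - zterm \<alpha> (r^2 - t^2) (varX + varX_inv) - zterm \<alpha> (s^2 - t^2) (varY + varY_inv)"

text \<open>
  The inverse with constant coefficient 1; the class-based \<open>inverse\<close> on power series is not available
  because Laurent polynomials do not form a field.
\<close>

definition inv_D :: "int \<Rightarrow> int \<Rightarrow> int \<Rightarrow> real \<Rightarrow> laurent fps" where
  "inv_D r s t \<alpha> = fps_right_inverse (denomD r s t \<alpha>) 1"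

lemma denomD_times_inv_D: "denomD r s t \<alpha> * inv_D r s t \<alpha> = 1"
  unfolding inv_D_def
  by (rule fps_right_inverse) (simp add: denomD_def zterm_def)

text \<open>The numerators of \<open>\<rho>\<^sub>p\<close> for \<open>0 \<le> p < 2 * t\<close>, for \<open>r \<le> s\<close> and \<open>s \<le> r\<close> respectively.\<close>

definition numer_le :: "int \<Rightarrow> int \<Rightarrow> int \<Rightarrow> real \<Rightarrow> int \<Rightarrow> laurent fps" where
  "numer_le r s t \<alpha> p =
     (if p < t - s then
        1 - zterm \<alpha> (r^2 - t^2) (varX + varX_inv) - zterm \<alpha> (s^2 - t^2) (varY + varY_inv)
      else if p < t - r then
        1 - zterm \<alpha> (r^2 - t^2) (varX + varX_inv) - zterm \<alpha> (s^2 - t^2) varY_inv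
      else if p < t + r then
        1 - zterm \<alpha> (r^2 - t^2) varX_inv - zterm \<alpha> (s^2 - t^2) varY_inv
      else if p < t + s then
        1 - zterm \<alpha> (s^2 - t^2) varY_inv
      else 1)"

definition numer_ge :: "int \<Rightarrow> int \<Rightarrow> int \<Rightarrow> real \<Rightarrow> int \<Rightarrow> laurent fps" where
  "numer_ge r s t \<alpha> p =
     (if p < t - r then
        1 - zterm \<alpha> (r^2 - t^2) (varX + varX_inv) - zterm \<alpha> (s^2 - t^2) (varY + varY_inv)
      else if p < t - s then
        1 - zterm \<alpha> (r^2 - t^2) varX_inv - zterm \<alpha> (s^2 - t^2) (varY + varY_inv)
      else if p < t + s then
        1 - zterm \<alpha> (r^2 - t^2) varX_inv - zterm \<alpha> (s^2 - t^2) varY_inv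
      else if p < t + r then
        1 - zterm \<alpha> (r^2 - t^2) varX_inv
      else 1)"

section \<open>The constant alpha is well defined\<close>

lemma ex1_alpha:
  fixes r s t :: int
  assumes "0 \<le> r" "r < t" "0 \<le> s" "s < t"
  shows "\<exists>!\<alpha>::real. \<alpha> > 1 \<and> \<alpha> powi (t^2) = \<alpha> powi (r^2) + \<alpha> powi (s^2)"
proof -
  define R S T where "R = nat (r^2)" and "S = nat (s^2)" and "T = nat (t^2)"
  have lt: "R < T" "S < T"
    using assms by (auto simp: R_def S_def T_def intro!: power_strict_mono)
  have pw: "x powi (r^2) = x ^ R" "x powi (s^2) = x ^ S" "x powi (t^2) = x ^ T" for x :: real
    by (simp_all add: R_def S_def T_def power_int_def)
  have "\<exists>x::real. 1 \<le> x \<and> x \<le> 2 \<and> x ^ T - x ^ R - x ^ S = 0"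
  proof (rule IVT')
    have "(2::real) ^ R \<le> 2 ^ (T - 1)" "(2::real) ^ S \<le> 2 ^ (T - 1)"
      using lt by (auto intro!: power_increasing)
    moreover have "(2::real) ^ T = 2 * 2 ^ (T - 1)"
      using lt by (cases T) auto
    ultimately show "0 \<le> (2::real) ^ T - 2 ^ R - 2 ^ S" by linarith
  qed (auto intro!: continuous_intros)
  then obtain a :: real where a: "1 \<le> a" "a ^ T = a ^ R + a ^ S" by force
  have "a > 1" using a by (cases "a = 1") auto
  have no: False if "1 < x" "x < y" "x ^ T = x ^ R + x ^ S" "y ^ T = y ^ R + y ^ S" for x y :: real
  proof -
    define q where "q = y / x"
    have q: "q > 1" "y = x * q" using that by (auto simp: q_def)
    have "x ^ R * q ^ R < x ^ R * q ^ T" "x ^ S * q ^ S < x ^ S * q ^ T"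
      using lt q that by (auto intro!: mult_strict_left_mono power_strict_increasing)
    hence "y ^ R + y ^ S < (x ^ R + x ^ S) * q ^ T"
      by (simp add: q(2) power_mult_distrib distrib_right)
    also have "\<dots> = y ^ T" using that by (simp add: q(2) power_mult_distrib)
    finally show False using that by simp
  qed
  show ?thesis
    unfolding pw
  proof (rule ex1I[of _ a])
    show "a > 1 \<and> a ^ T = a ^ R + a ^ S" using \<open>a > 1\<close> a by simp
  next
    fix y :: real assume "1 < y \<and> y ^ T = y ^ R + y ^ S"
    thus "y = a" using no[of y a] no[of a y] \<open>a > 1\<close> a by (cases y a rule: linorder_cases) auto
  qed
qed

end

theory Submission
  imports Defs
begin

text \<open>
  Logarithmic differentiation of the T-system at the uniform solution gives a linear recurrence
  with constant coefficients, so multiplying the generating function by \<open>D\<close> leaves only boundary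
  terms at points with \<open>0 \<le> mu < 2 * t\<close>. There the density is a delta function, and a neighbour
  term such as \<open>x z\<close> survives precisely when the point it reaches from the marked initial point is
  still in the initial slab (for \<open>x z\<close>, when \<open>p + r + t < 2 * t\<close>). Both sides of the theorem satisfy
  the resulting recurrence, vanish for \<open>k < k\<^sub>0\<close>, and are therefore equal by induction on \<open>k\<close>.
\<close>

section \<open>Coefficients of formal series\<close>

text \<open>Exponents form a group, so \<open>k = l + q\<close> can be solved for \<open>q\<close>;
  this collapses both sums of the convolution to one term.\<close>

lemma lookup_single_times:
  fixes f :: "'a::ab_group_add \<Rightarrow>\<^sub>0 'b::semiring_0"
  shows "Poly_Mapping.lookup (Poly_Mapping.single a c * f) k = c * Poly_Mapping.lookup f (k - a)"
proof -
  have eq: "(k = l + q) = (k - l = q)" for l q :: 'a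
    by (auto simp: algebra_simps)
  show ?thesis
    by (simp add: times_poly_mapping.rep_eq prod_fun_def lookup_single eq when_mult)
qed

lemma series_coeffs_0 [simp]: "series_coeffs 0 i j k = 0"
  by (simp add: series_coeffs_def)

lemma series_coeffs_add [simp]:
  "series_coeffs (F + G) i j k = series_coeffs F i j k + series_coeffs G i j k"
  by (simp add: series_coeffs_def lookup_add)

lemma series_coeffs_diff [simp]:
  "series_coeffs (F - G) i j k = series_coeffs F i j k - series_coeffs G i j k"
  by (simp add: series_coeffs_def lookup_minus)

lemma series_coeffs_lconst_times [simp]:
  "series_coeffs (fls_const (lconst w) * F) i j k = w * series_coeffs F i j k"
  by (simp add: series_coeffs_def lconst_def lookup_single_times)

lemma series_coeffs_monomial3_times [simp]:
  "series_coeffs (monomial3 a b c * F) i j k = series_coeffs F (i - a) (j - b) (k - c)"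
  by (simp only: series_coeffs_def monomial3_def mult.assoc fls_X_intpow_times_conv_shift(1))
     (simp add: lmonom_def lookup_single_times)

lemma monomial3_mult: "monomial3 a b c * monomial3 a' b' c' = monomial3 (a + a') (b + b') (c + c')"
proof -
  have "monomial3 a b c * monomial3 a' b' c' =
      fls_const (lmonom a b) * fls_const (lmonom a' b') * (fls_X_intpow c * fls_X_intpow c')"
    unfolding monomial3_def by (simp only: mult_ac)
  also have "\<dots> = monomial3 (a + a') (b + b') (c + c')"
    unfolding fls_X_intpow_times_fls_X_intpow
    by (simp add: monomial3_def lmonom_def mult_single)
  finally show ?thesis .
qed

lemma series_coeffs_monomial3:
  "series_coeffs (monomial3 a b c) i j k = (if i = a \<and> j = b \<and> k = c then 1 else 0)"
  by (auto simp: series_coeffs_def monomial3_def lmonom_def lookup_single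
      fls_X_intpow_times_conv_shift)

lemma fls_X_eq_monomial3: "fls_X = monomial3 0 0 1"
  by (simp add: monomial3_def lmonom_def fls_X_conv_shift_1 flip: zero_prod_def)

lemma fps_to_fls_zterm_lmonom:
  "fps_to_fls (zterm \<alpha> e (lmonom a b)) = fls_const (lconst (\<alpha> powi e)) * monomial3 a b 1"
  unfolding zterm_def monomial3_def fls_times_fps_to_fls fps_X_to_fls fps_const_to_fls
    fls_X_conv_shift_1 fls_const_mult_const[symmetric]
  by (simp only: mult_ac)

lemma zterm_add: "zterm \<alpha> e (p + q) = zterm \<alpha> e p + zterm \<alpha> e q"
  by (simp add: zterm_def algebra_simps flip: fps_const_add)

lemma zterm_0 [simp]: "zterm \<alpha> e 0 = 0"
  by (simp add: zterm_def)

lemma fps_to_fls_denomD: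
  "fps_to_fls (denomD r s t \<alpha>) = 1 + monomial3 0 0 2
     - fls_const (lconst (\<alpha> powi (r^2 - t^2))) * (monomial3 1 0 1 + monomial3 (-1) 0 1)
     - fls_const (lconst (\<alpha> powi (s^2 - t^2))) * (monomial3 0 1 1 + monomial3 0 (-1) 1)"
  by (simp add: denomD_def zterm_add fps_to_fls_zterm_lmonom fls_times_fps_to_fls fls_X_eq_monomial3
      power2_eq_square monomial3_mult distrib_left)

text \<open>This is how \<open>D\<close> encodes the recurrence: a coefficient of a product with
  \<open>D\<close> is the defect of the density recurrence whose topmost point is
  \<open>(i, j, k)\<close>.\<close>

lemma series_coeffs_denomD_times:
  "series_coeffs (fps_to_fls (denomD r s t \<alpha>) * F) i j k =
     series_coeffs F i j k + series_coeffs F i j (k - 2)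
     - \<alpha> powi (r^2 - t^2) * (series_coeffs F (i - 1) j (k - 1) + series_coeffs F (i + 1) j (k - 1))
     - \<alpha> powi (s^2 - t^2) * (series_coeffs F i (j - 1) (k - 1) + series_coeffs F i (j + 1) (k - 1))"
  by (simp add: fps_to_fls_denomD left_diff_distrib distrib_right mult.assoc)

section \<open>The numerators\<close>

text \<open>A uniform form of both case lists: each of the four neighbour terms has its own
  threshold for \<open>p\<close>, whatever the order of \<open>r\<close> and
  \<open>s\<close>.\<close>

definition numer :: "int \<Rightarrow> int \<Rightarrow> int \<Rightarrow> real \<Rightarrow> int \<Rightarrow> laurent fps" where
  "numer r s t \<alpha> p = 1
     - zterm \<alpha> (r^2 - t^2) ((if p < t - r then varX else 0) + (if p < t + r then varX_inv else 0))
     - zterm \<alpha> (s^2 - t^2) ((if p < t - s then varY else 0) + (if p < t + s then varY_inv else 0))"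

text \<open>Here \<open>t - s \<le> t - r \<le> t + r \<le> t + s\<close>, so the four separate
  conditions of \<open>numer\<close> combine to exactly five cases.\<close>

lemma numer_le_eq_numer: "0 \<le> r \<Longrightarrow> r \<le> s \<Longrightarrow> numer_le r s t \<alpha> p = numer r s t \<alpha> p"
  by (simp add: numer_le_def numer_def)

lemma numer_ge_eq_numer: "0 \<le> s \<Longrightarrow> s \<le> r \<Longrightarrow> numer_ge r s t \<alpha> p = numer r s t \<alpha> p"
  by (simp add: numer_ge_def numer_def)

lemma series_coeffs_monomial3_zterm:
  "series_coeffs (monomial3 a b c * fps_to_fls (zterm \<alpha> e (if P then lmonom u v else 0))) i j k =
     \<alpha> powi e * (if P \<and> i = a + u \<and> j = b + v \<and> k = c + 1 then 1 else 0)"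
  by (auto simp: fps_to_fls_zterm_lmonom series_coeffs_monomial3)

lemma series_coeffs_monomial3_numer:
  "series_coeffs (monomial3 a b c * fps_to_fls (numer r s t \<alpha> p)) i j k =
     (if i = a \<and> j = b \<and> k = c then 1 else 0)
     - \<alpha> powi (r^2 - t^2) *
         ((if p < t - r \<and> i = a + 1 \<and> j = b \<and> k = c + 1 then 1 else 0)
        + (if p < t + r \<and> i = a - 1 \<and> j = b \<and> k = c + 1 then 1 else 0))
     - \<alpha> powi (s^2 - t^2) *
         ((if p < t - s \<and> i = a \<and> j = b + 1 \<and> k = c + 1 then 1 else 0)
        + (if p < t + s \<and> i = a \<and> j = b - 1 \<and> k = c + 1 then 1 else 0))"
  \<comment> \<open>The general shift rule is switched off because it could rewrite the products
    before the rule for conditional terms matches.\<close>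
  by (simp add: numer_def zterm_add right_diff_distrib distrib_left series_coeffs_monomial3_zterm
      series_coeffs_monomial3 del: series_coeffs_monomial3_times split del: if_split)

section \<open>The uniform solution\<close>

definition tri :: "int \<Rightarrow> int" where
  "tri m = m * (m - 1) div 2"

lemma two_tri: "2 * tri m = m * (m - 1)"
  by (simp add: tri_def)

text \<open>\<open>tri\<close> is quadratic with leading coefficient 1/2, so its symmetric second
  difference with step \<open>r\<close> is the constant \<open>r^2\<close>. Hence the squares in the
  equation for \<alpha>.\<close>

lemma tri_add_tri_diff: "tri (m + r) + tri (m - r) = 2 * tri m + r^2"
proof -
  have "2 * (tri (m + r) + tri (m - r)) = 2 * (2 * tri m + r^2)"
    by (simp add: distrib_left two_tri) (simp add: algebra_simps power2_eq_square)
  thus ?thesis by simp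
qed

lemma powi_tri_mult:
  assumes "\<alpha> > (0::real)"
  shows "\<alpha> powi tri (m + r) * \<alpha> powi tri (m - r) = \<alpha> powi (2 * tri m) * \<alpha> powi (r^2)"
  using assms by (simp add: tri_add_tri_diff flip: power_int_add)

lemma init_height_eq:
  assumes "0 < t" "even (i + j + k)" "mu r s t i j k \<in> {0..2*t - 1}"
  shows "init_height r s t i j = k"
  unfolding init_height_def using ex1_init_height[OF assms(1), of i j r s] assms(2,3)
  by (intro the1_equality) auto

lemma uniform_data_pos: "\<alpha> > 0 \<Longrightarrow> uniform_data r s t \<alpha> i j > 0"
  by (simp add: uniform_data_def Let_def)

text \<open>If \<open>m\<close> is the value of \<open>mu\<close> at the centre, the products of
  opposite neighbours share the factor \<open>\<alpha> powi (2 * tri m)\<close>; what remains is the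
  equation for \<alpha>.\<close>

lemma T_solution_uniform:
  assumes "0 \<le> r" "r < t" "0 \<le> s" "s < t" "\<alpha> > 0"
    and "\<alpha> powi (t^2) = \<alpha> powi (r^2) + \<alpha> powi (s^2)"
  shows "T_solution r s t (uniform_data r s t \<alpha>) (\<lambda>i j k. \<alpha> powi tri (mu r s t i j k))"
  unfolding T_solution_def
proof (intro conjI allI impI)
  fix i j k
  assume "even (i + j + k) \<and> mu r s t i j k \<in> {0..2*t - 1}"
  with assms show "\<alpha> powi tri (mu r s t i j k) = uniform_data r s t \<alpha> i j"
    by (simp add: uniform_data_def init_height_eq tri_def Let_def)
next
  fix i j k
  define m where "m = mu r s t i j k"
  have eqs: "mu r s t (i + 1) j k = m + r" "mu r s t (i - 1) j k = m - r"
    "mu r s t i (j + 1) k = m + s" "mu r s t i (j - 1) k = m - s"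
    "mu r s t i j (k + 1) = m + t" "mu r s t i j (k - 1) = m - t"
    by (simp_all add: m_def mu_def algebra_simps)
  show "\<alpha> powi tri (mu r s t i j (k + 1)) * \<alpha> powi tri (mu r s t i j (k - 1)) =
      \<alpha> powi tri (mu r s t (i + 1) j k) * \<alpha> powi tri (mu r s t (i - 1) j k) +
      \<alpha> powi tri (mu r s t i (j + 1) k) * \<alpha> powi tri (mu r s t i (j - 1) k)"
    unfolding eqs using assms by (simp add: powi_tri_mult distrib_left)
qed

lemma slanted_T_uniform:
  assumes "0 \<le> r" "r < t" "0 \<le> s" "s < t" "\<alpha> > 0"
    and "\<alpha> powi (t^2) = \<alpha> powi (r^2) + \<alpha> powi (s^2)"
    and "even (i + j + k)" "0 \<le> mu r s t i j k"
  shows "slanted_T r s t (uniform_data r s t \<alpha>) i j k = \<alpha> powi tri (mu r s t i j k)"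
  using T_solution_unique[OF assms(1-4) _ T_solution_uniform[OF assms(1-6)] assms(7,8)]
    uniform_data_pos[OF assms(5)] by simp

section \<open>Logarithmic derivatives\<close>

text \<open>Induction along the recursion. Only the division could fail, and its denominator is
  nonzero because positive data give a positive solution.\<close>

lemma differentiable_slanted_T:
  fixes \<tau> :: "int \<Rightarrow> int \<Rightarrow> real"
  assumes "\<And>i j. \<tau> i j > 0"
  shows "(\<lambda>u. slanted_T r s t (\<tau>(a := (\<tau> a)(b := u))) i j k) differentiable (at (\<tau> a b))"
  using assms
proof (induction r s t \<tau> i j k rule: slanted_T.induct)
  case (1 r s t \<tau> i j k)
  show ?case
  proof (cases "\<bar>r\<bar> < t \<and> \<bar>s\<bar> < t \<and> 2 * t \<le> mu r s t i j k")
    case True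
    have "slanted_T r s t \<tau> i j (k - 2) \<noteq> 0"
      using slanted_T_pos[of \<tau> r s t i j "k - 2"] 1 by simp
    thus ?thesis
      using True by (subst slanted_T.simps, simp) (intro derivative_intros 1; simp)
  next
    case False
    have "(\<lambda>u. (\<tau>(a := (\<tau> a)(b := u))) i j) differentiable (at (\<tau> a b))"
      by (cases "i = a"; cases "j = b") (auto intro: derivative_intros)
    thus ?thesis using False by (subst slanted_T.simps) auto
  qed
qed

lemma log_deriv_T_initial:
  assumes "mu r s t i j k < 2 * t" "\<tau> i j \<noteq> 0"
  shows "log_deriv_T r s t \<tau> a b i j k = (if i = a \<and> j = b then 1 else 0)"
proof -
  have "slanted_T r s t \<sigma> i j k = \<sigma> i j" for \<sigma>
    using assms(1) by (subst slanted_T.simps) simp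
  thus ?thesis
    using assms(2) by (cases "i = a") (auto simp: log_deriv_T_def)
qed

text \<open>Apply \<open>u d/du\<close> to the T-system in product form: by the Leibniz rule, each
  product of two values of \<open>T\<close> is multiplied by the sum of their logarithmic
  derivatives.\<close>

lemma log_deriv_T_step:
  fixes \<tau> :: "int \<Rightarrow> int \<Rightarrow> real" and a b :: int
  assumes bnd: "\<bar>r\<bar> < t" "\<bar>s\<bar> < t" "2 * t \<le> mu r s t i j k" and pos: "\<And>i j. \<tau> i j > 0"
  defines "T \<equiv> slanted_T r s t \<tau>" and "L \<equiv> log_deriv_T r s t \<tau> a b"
  shows "T i j k * T i j (k - 2) * (L i j k + L i j (k - 2)) =
     T (i + 1) j (k - 1) * T (i - 1) j (k - 1) * (L (i + 1) j (k - 1) + L (i - 1) j (k - 1)) +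
     T i (j + 1) (k - 1) * T i (j - 1) (k - 1) * (L i (j + 1) (k - 1) + L i (j - 1) (k - 1))"
proof -
  define f where "f = (\<lambda>i j k u. slanted_T r s t (\<tau>(a := (\<tau> a)(b := u))) i j k)"
  define u0 where "u0 = \<tau> a b"
  define d where "d = (\<lambda>i j k. deriv (f i j k) u0)"
  have f_T: "f i j k u0 = T i j k" for i j k
    by (simp add: f_def T_def u0_def)
  have Tpos: "T i j k > 0" for i j k
    unfolding T_def by (rule slanted_T_pos) (rule pos)
  have der: "(f i j k has_real_derivative d i j k) (at u0)" for i j k
    using differentiable_slanted_T[of \<tau> r s t a b i j k] pos
    by (simp add: f_def d_def u0_def DERIV_deriv_iff_real_differentiable)
  have TL: "T i j k * L i j k = u0 * d i j k" for i j k
    using Tpos[of i j k] by (simp add: L_def log_deriv_T_def T_def d_def f_def u0_def)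
  let ?rhs = "\<lambda>u. f (i + 1) j (k - 1) u * f (i - 1) j (k - 1) u
                 + f i (j + 1) (k - 1) u * f i (j - 1) (k - 1) u"
  \<comment> \<open>Positivity of \<open>u\<close> keeps the divisor \<open>f i j (k - 2) u\<close>
    nonzero, so the recursion can be multiplied out.\<close>
  have prod: "f i j k u * f i j (k - 2) u = ?rhs u" if "u > 0" for u
  proof -
    have "slanted_T r s t (\<tau>(a := (\<tau> a)(b := u))) i j (k - 2) > 0"
      by (rule slanted_T_pos) (use pos that in simp)
    thus ?thesis
      unfolding f_def by (subst slanted_T.simps) (use bnd in simp)
  qed
  have lhs: "((\<lambda>u. f i j k u * f i j (k - 2) u) has_real_derivative
      d i j k * T i j (k - 2) + d i j (k - 2) * T i j k) (at u0)"
    using DERIV_mult[OF der der] by (simp add: f_T)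
  have rhs: "(?rhs has_real_derivative
      (d (i + 1) j (k - 1) * T (i - 1) j (k - 1) + d (i - 1) j (k - 1) * T (i + 1) j (k - 1)) +
      (d i (j + 1) (k - 1) * T i (j - 1) (k - 1) + d i (j - 1) (k - 1) * T i (j + 1) (k - 1)))
      (at u0)"
    using DERIV_add[OF DERIV_mult[OF der der] DERIV_mult[OF der der]] by (simp add: f_T)
  \<comment> \<open>The identity holds near \<open>u0 > 0\<close>, which suffices to equate the two
    derivatives there.\<close>
  have ev: "\<forall>\<^sub>F u in nhds u0. f i j k u * f i j (k - 2) u = ?rhs u"
  proof (rule eventually_mono)
    show "\<forall>\<^sub>F u in nhds u0. u \<in> {0<..}"
      using pos by (intro eventually_nhds_in_open) (auto simp: u0_def)
  qed (use prod in auto)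
  have "d i j k * T i j (k - 2) + d i j (k - 2) * T i j k =
      (d (i + 1) j (k - 1) * T (i - 1) j (k - 1) + d (i - 1) j (k - 1) * T (i + 1) j (k - 1)) +
      (d i (j + 1) (k - 1) * T i (j - 1) (k - 1) + d i (j - 1) (k - 1) * T i (j + 1) (k - 1))"
    using lhs rhs unfolding DERIV_cong_ev[OF refl ev refl] by (rule DERIV_unique)
  hence "u0 * (d i j k * T i j (k - 2) + d i j (k - 2) * T i j k) =
      u0 * ((d (i + 1) j (k - 1) * T (i - 1) j (k - 1) + d (i - 1) j (k - 1) * T (i + 1) j (k - 1)) +
      (d i (j + 1) (k - 1) * T i (j - 1) (k - 1) + d i (j - 1) (k - 1) * T i (j + 1) (k - 1)))"
    by simp
  hence "(u0 * d i j k) * T i j (k - 2) + (u0 * d i j (k - 2)) * T i j k =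
      (u0 * d (i + 1) j (k - 1)) * T (i - 1) j (k - 1) +
      (u0 * d (i - 1) j (k - 1)) * T (i + 1) j (k - 1) +
      (u0 * d i (j + 1) (k - 1)) * T i (j - 1) (k - 1) +
      (u0 * d i (j - 1) (k - 1)) * T i (j + 1) (k - 1)"
    by (simp only: distrib_left mult.assoc add.assoc)
  thus ?thesis
    unfolding TL[symmetric] by (simp add: algebra_simps)
qed

text \<open>At the uniform solution the three products in \<open>log_deriv_T_step\<close> are a
  common factor \<open>A\<close> times \<alpha> to the powers \<open>t^2\<close>, \<open>r^2\<close>
  and \<open>s^2\<close>; dividing by the first gives the constant weights.\<close>

lemma density_recurrence:
  fixes a b :: int
  assumes rst: "0 \<le> r" "r < t" "0 \<le> s" "s < t" and "\<alpha> > 0"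
    and "\<alpha> powi (t^2) = \<alpha> powi (r^2) + \<alpha> powi (s^2)"
    and "even (i + j + k)" "2 * t \<le> mu r s t i j k"
  defines "\<rho> \<equiv> density r s t \<alpha> a b"
  shows "\<rho> i j k + \<rho> i j (k - 2) =
     \<alpha> powi (r^2 - t^2) * (\<rho> (i + 1) j (k - 1) + \<rho> (i - 1) j (k - 1)) +
     \<alpha> powi (s^2 - t^2) * (\<rho> i (j + 1) (k - 1) + \<rho> i (j - 1) (k - 1))"
proof -
  \<comment> \<open>The value of \<open>mu\<close> at the centre \<open>(i, j, k - 1)\<close>. The
    bound \<open>t \<le> n\<close> below puts all six neighbours at \<open>mu \<ge> 0\<close>, where
    the uniform formula is available.\<close>
  define n where "n = mu r s t i j k - t"
  have eqs: "mu r s t (i + 1) j (k - 1) = n + r" "mu r s t (i - 1) j (k - 1) = n - r"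
    "mu r s t i (j + 1) (k - 1) = n + s" "mu r s t i (j - 1) (k - 1) = n - s"
    "mu r s t i j k = n + t" "mu r s t i j (k - 2) = n - t"
    by (simp_all add: n_def mu_def algebra_simps)
  have n: "t \<le> n" using assms by (simp add: n_def)
  define A where "A = \<alpha> powi (2 * tri n)"
  have "A > 0" "\<alpha> powi (t^2) > 0" using \<open>\<alpha> > 0\<close> by (auto simp: A_def)
  have unif: "slanted_T r s t (uniform_data r s t \<alpha>) i' j' k' = \<alpha> powi tri (mu r s t i' j' k')"
    if "even (i' + j' + k')" "0 \<le> mu r s t i' j' k'" for i' j' k'
    by (rule slanted_T_uniform[OF assms(1-6) that])
  have par: "even (i + j + (k - 2))" "even (i + 1 + j + (k - 1))" "even (i - 1 + j + (k - 1))"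
    "even (i + (j + 1) + (k - 1))" "even (i + (j - 1) + (k - 1))"
    using \<open>even (i + j + k)\<close> by presburger+
  have vals:
    "slanted_T r s t (uniform_data r s t \<alpha>) i j k * slanted_T r s t (uniform_data r s t \<alpha>) i j (k - 2)
       = A * \<alpha> powi (t^2)"
    "slanted_T r s t (uniform_data r s t \<alpha>) (i + 1) j (k - 1) *
       slanted_T r s t (uniform_data r s t \<alpha>) (i - 1) j (k - 1) = A * \<alpha> powi (r^2)"
    "slanted_T r s t (uniform_data r s t \<alpha>) i (j + 1) (k - 1) *
       slanted_T r s t (uniform_data r s t \<alpha>) i (j - 1) (k - 1) = A * \<alpha> powi (s^2)"
    using n rst
    by (simp_all add: unif[OF \<open>even (i + j + k)\<close>] par[THEN unif] eqs A_def
        powi_tri_mult[OF \<open>\<alpha> > 0\<close>])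
  have "A * \<alpha> powi (t^2) * (\<rho> i j k + \<rho> i j (k - 2)) =
     A * \<alpha> powi (r^2) * (\<rho> (i + 1) j (k - 1) + \<rho> (i - 1) j (k - 1)) +
     A * \<alpha> powi (s^2) * (\<rho> i (j + 1) (k - 1) + \<rho> i (j - 1) (k - 1))"
    using log_deriv_T_step[of r t s i j k "uniform_data r s t \<alpha>" a b] assms(1-5,8)
    by (simp add: vals \<rho>_def density_def uniform_data_pos)
  hence "A * (\<alpha> powi (t^2) * (\<rho> i j k + \<rho> i j (k - 2))) =
     A * (\<alpha> powi (r^2) * (\<rho> (i + 1) j (k - 1) + \<rho> (i - 1) j (k - 1)) +
     \<alpha> powi (s^2) * (\<rho> i (j + 1) (k - 1) + \<rho> i (j - 1) (k - 1)))"
    by (simp only: distrib_left mult.assoc)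
  with \<open>A > 0\<close> have "\<alpha> powi (t^2) * (\<rho> i j k + \<rho> i j (k - 2)) =
     \<alpha> powi (r^2) * (\<rho> (i + 1) j (k - 1) + \<rho> (i - 1) j (k - 1)) +
     \<alpha> powi (s^2) * (\<rho> i (j + 1) (k - 1) + \<rho> i (j - 1) (k - 1))"
    by simp
  thus ?thesis
    using \<open>\<alpha> powi (t^2) > 0\<close> \<open>\<alpha> > 0\<close> by (simp add: power_int_diff field_simps)
qed

section \<open>The density generating function\<close>

text \<open>\<open>density\<close> sees the marked point only through \<open>(a, b)\<close>; the
  condition \<open>k = c\<close> comes from the uniqueness of the initial height. Elsewhere the
  series is cut off to 0, and the marked point is not among those points.\<close>

lemma density_gf_initial:
  assumes "0 < t" "\<alpha> > 0" "even (a + b + c)" "mu r s t a b c \<in> {0..2*t - 1}"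
    and "mu r s t i j k < 2 * t"
  shows "density_gf r s t \<alpha> a b i j k = (if i = a \<and> j = b \<and> k = c then 1 else 0)"
proof (cases "even (i + j + k) \<and> 0 \<le> mu r s t i j k")
  case True
  have "init_height r s t i j = k"
    by (rule init_height_eq) (use True assms in auto)
  hence "k = c" if "i = a" "j = b"
    using init_height_eq[OF assms(1,3,4)] that by simp
  moreover have "density r s t \<alpha> a b i j k = (if i = a \<and> j = b then 1 else 0)"
    unfolding density_def using uniform_data_pos[OF assms(2), of r s t i j] assms(5)
    by (intro log_deriv_T_initial) auto
  ultimately show ?thesis using True by (auto simp: density_gf_def)
next
  case False
  thus ?thesis using assms by (auto simp: density_gf_def)
qed

text \<open>All six points have the same parity. In the even case they satisfy
  \<open>mu \<ge> 0\<close>, so the cut-off is invisible; in the odd case every term is 0.\<close>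

lemma density_gf_recurrence:
  fixes a b :: int
  assumes rst: "0 \<le> r" "r < t" "0 \<le> s" "s < t" and "\<alpha> > 0"
    and "\<alpha> powi (t^2) = \<alpha> powi (r^2) + \<alpha> powi (s^2)"
    and "2 * t \<le> mu r s t i j k"
  defines "\<rho> \<equiv> density_gf r s t \<alpha> a b"
  shows "\<rho> i j k + \<rho> i j (k - 2)
     - \<alpha> powi (r^2 - t^2) * (\<rho> (i - 1) j (k - 1) + \<rho> (i + 1) j (k - 1))
     - \<alpha> powi (s^2 - t^2) * (\<rho> i (j - 1) (k - 1) + \<rho> i (j + 1) (k - 1)) = 0"
proof (cases "even (i + j + k)")
  case True
  have par: "even (i + j + (k - 2))" "even (i + 1 + j + (k - 1))" "even (i - 1 + j + (k - 1))"
    "even (i + (j + 1) + (k - 1))" "even (i + (j - 1) + (k - 1))"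
    using True by presburger+
  have "mu r s t i j k \<ge> 0" "mu r s t i j (k - 2) \<ge> 0"
    "mu r s t (i + 1) j (k - 1) \<ge> 0" "mu r s t (i - 1) j (k - 1) \<ge> 0"
    "mu r s t i (j + 1) (k - 1) \<ge> 0" "mu r s t i (j - 1) (k - 1) \<ge> 0"
    using assms(1-4,7) by (simp_all add: mu_def algebra_simps)
  hence "\<rho> i j k = density r s t \<alpha> a b i j k" "\<rho> i j (k - 2) = density r s t \<alpha> a b i j (k - 2)"
    "\<rho> (i + 1) j (k - 1) = density r s t \<alpha> a b (i + 1) j (k - 1)"
    "\<rho> (i - 1) j (k - 1) = density r s t \<alpha> a b (i - 1) j (k - 1)"
    "\<rho> i (j + 1) (k - 1) = density r s t \<alpha> a b i (j + 1) (k - 1)"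
    "\<rho> i (j - 1) (k - 1) = density r s t \<alpha> a b i (j - 1) (k - 1)"
    using True par by (simp_all only: \<rho>_def density_gf_def simp_thms if_True)
  with density_recurrence[OF assms(1-6) True assms(7), of a b] show ?thesis
    by (simp add: add.commute)
next
  case False
  hence "odd (i + j + (k - 2))" "odd (i + 1 + j + (k - 1))" "odd (i - 1 + j + (k - 1))"
    "odd (i + (j + 1) + (k - 1))" "odd (i + (j - 1) + (k - 1))"
    by presburger+
  with False show ?thesis
    by (simp only: \<rho>_def density_gf_def simp_thms if_False) simp
qed

text \<open>For \<open>mu < 2 * t\<close> all points involved lie in or below the initial slab, so
  only delta functions occur. Above it the recurrence makes the left side 0, and the thresholds
  exclude every term of the numerator.\<close>

lemma density_gf_denomD:
  fixes a b :: int
  assumes rst: "0 \<le> r" "r < t" "0 \<le> s" "s < t" and "\<alpha> > 0"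
    and "\<alpha> powi (t^2) = \<alpha> powi (r^2) + \<alpha> powi (s^2)"
    and abc: "even (a + b + c)" "mu r s t a b c \<in> {0..2*t - 1}"
  defines "\<rho> \<equiv> density_gf r s t \<alpha> a b"
  shows "\<rho> i j k + \<rho> i j (k - 2)
     - \<alpha> powi (r^2 - t^2) * (\<rho> (i - 1) j (k - 1) + \<rho> (i + 1) j (k - 1))
     - \<alpha> powi (s^2 - t^2) * (\<rho> i (j - 1) (k - 1) + \<rho> i (j + 1) (k - 1)) =
     series_coeffs (monomial3 a b c * fps_to_fls (numer r s t \<alpha> (mu r s t a b c))) i j k"
proof (cases "mu r s t i j k < 2 * t")
  case True
  have init: "\<rho> i' j' k' = (if i' = a \<and> j' = b \<and> k' = c then 1 else 0)"
    if "mu r s t i' j' k' < 2 * t" for i' j' k'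
    unfolding \<rho>_def using density_gf_initial[OF _ _ abc that, of \<alpha>] rst \<open>\<alpha> > 0\<close> by simp
  have lt: "mu r s t i j (k - 2) < 2 * t"
    "mu r s t (i + 1) j (k - 1) < 2 * t" "mu r s t (i - 1) j (k - 1) < 2 * t"
    "mu r s t i (j + 1) (k - 1) < 2 * t" "mu r s t i (j - 1) (k - 1) < 2 * t"
    using True rst by (simp_all add: mu_def algebra_simps)
  \<comment> \<open>The point two levels above the marked one has \<open>mu \<ge> 2 * t\<close>.
    This is why no numerator contains \<open>z^2\<close>.\<close>
  have ne: "\<not> (i = a \<and> j = b \<and> k - 2 = c)"
    using True abc by (auto simp: mu_def algebra_simps)
  \<comment> \<open>One step from the marked point changes \<open>mu\<close> by \<open>t\<close>
    plus or minus \<open>r\<close> or \<open>s\<close>, so \<open>mu < 2 * t\<close> at the point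
    reached is precisely the threshold in \<open>numer\<close>.\<close>
  have nb: "(i - 1 = a \<and> j = b \<and> k - 1 = c) \<longleftrightarrow>
        (mu r s t a b c < t - r \<and> i = a + 1 \<and> j = b \<and> k = c + 1)"
      "(i + 1 = a \<and> j = b \<and> k - 1 = c) \<longleftrightarrow>
        (mu r s t a b c < t + r \<and> i = a - 1 \<and> j = b \<and> k = c + 1)"
      "(i = a \<and> j - 1 = b \<and> k - 1 = c) \<longleftrightarrow>
        (mu r s t a b c < t - s \<and> i = a \<and> j = b + 1 \<and> k = c + 1)"
      "(i = a \<and> j + 1 = b \<and> k - 1 = c) \<longleftrightarrow>
        (mu r s t a b c < t + s \<and> i = a \<and> j = b - 1 \<and> k = c + 1)"
    using True by (auto simp: mu_def algebra_simps)
  show ?thesis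
    unfolding series_coeffs_monomial3_numer init[OF True] lt[THEN init] nb using ne by simp
next
  case False
  hence "\<not> (i = a \<and> j = b \<and> k = c)"
    "\<not> (mu r s t a b c < t - r \<and> i = a + 1 \<and> j = b \<and> k = c + 1)"
    "\<not> (mu r s t a b c < t + r \<and> i = a - 1 \<and> j = b \<and> k = c + 1)"
    "\<not> (mu r s t a b c < t - s \<and> i = a \<and> j = b + 1 \<and> k = c + 1)"
    "\<not> (mu r s t a b c < t + s \<and> i = a \<and> j = b - 1 \<and> k = c + 1)"
    using abc by (auto simp: mu_def algebra_simps)
  hence "series_coeffs (monomial3 a b c * fps_to_fls (numer r s t \<alpha> (mu r s t a b c))) i j k = 0"
    unfolding series_coeffs_monomial3_numer by (simp only: if_False) simp
  with density_gf_recurrence[OF assms(1-6), of i j k a b] False show ?thesis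
    by (simp add: \<rho>_def)
qed

lemma recurrence_unique:
  fixes f g :: "int \<Rightarrow> int \<Rightarrow> int \<Rightarrow> real"
  assumes low: "\<And>i j k. k < c \<Longrightarrow> f i j k = g i j k"
    and rec: "\<And>i j k. c \<le> k \<Longrightarrow>
      f i j k + f i j (k - 2) - v * (f (i - 1) j (k - 1) + f (i + 1) j (k - 1))
        - w * (f i (j - 1) (k - 1) + f i (j + 1) (k - 1)) =
      g i j k + g i j (k - 2) - v * (g (i - 1) j (k - 1) + g (i + 1) j (k - 1))
        - w * (g i (j - 1) (k - 1) + g i (j + 1) (k - 1))"
  shows "f = g"
proof -
  have "f i j k = g i j k" for i j k
  \<comment> \<open>The offset keeps the measure positive at \<open>k = c\<close>, so the induction
    hypothesis also covers the levels \<open>c - 1\<close> and \<open>c - 2\<close>.\<close>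
  proof (induction "nat (k - c + 2)" arbitrary: i j k rule: less_induct)
    case less
    show ?case
    proof (cases "k < c")
      case False
      hence "f i' j' (k - 1) = g i' j' (k - 1)" "f i' j' (k - 2) = g i' j' (k - 2)" for i' j'
        by (auto intro: less)
      with rec[of k i j] False show ?thesis by simp
    qed (rule low)
  qed
  thus ?thesis by blast
qed

text \<open>Heights are unbounded below, so the induction runs on \<open>mu\<close>, which drops at
  every point the recurrence refers to. Those points stay below height \<open>c\<close>, and in the
  slab the only nonzero value sits at height \<open>c\<close>.\<close>

lemma density_gf_below:
  assumes "0 \<le> r" "r < t" "0 \<le> s" "s < t" "\<alpha> > 0"
    and "\<alpha> powi (t^2) = \<alpha> powi (r^2) + \<alpha> powi (s^2)"
    and abc: "even (a + b + c)" "mu r s t a b c \<in> {0..2*t - 1}"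
    and "k < c"
  shows "density_gf r s t \<alpha> a b i j k = 0"
  using \<open>k < c\<close>
proof (induction "nat (mu r s t i j k)" arbitrary: i j k rule: less_induct)
  case less
  show ?case
  proof (cases "mu r s t i j k < 2 * t")
    case True
    thus ?thesis using density_gf_initial[OF _ _ abc True, of \<alpha>] less.prems assms by simp
  next
    case False
    have "density_gf r s t \<alpha> a b i j (k - 2) = 0"
      "density_gf r s t \<alpha> a b (i + 1) j (k - 1) = 0" "density_gf r s t \<alpha> a b (i - 1) j (k - 1) = 0"
      "density_gf r s t \<alpha> a b i (j + 1) (k - 1) = 0" "density_gf r s t \<alpha> a b i (j - 1) (k - 1) = 0"
      using False less.prems assms(1-4)
      by (intro less.hyps; simp add: mu_def algebra_simps)+
    with density_gf_recurrence[OF assms(1-6), of i j k a b] False show ?thesis by simp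
  qed
qed

lemma density_gf_eq:
  assumes "0 \<le> r" "r < t" "0 \<le> s" "s < t" "\<alpha> > 0"
    and "\<alpha> powi (t^2) = \<alpha> powi (r^2) + \<alpha> powi (s^2)"
    and "even (a + b + c)" "mu r s t a b c \<in> {0..2*t - 1}"
  shows "density_gf r s t \<alpha> a b = series_coeffs
     (monomial3 a b c * fps_to_fls (inv_D r s t \<alpha> * numer r s t \<alpha> (mu r s t a b c)))"
    (is "_ = series_coeffs ?F")
proof (rule recurrence_unique)
  fix i j k :: int
  assume "k < c"
  thus "density_gf r s t \<alpha> a b i j k = series_coeffs ?F i j k"
    \<comment> \<open>After the shift by \<open>c\<close> the exponent of \<open>z\<close> is
      negative, where a power series has coefficient 0.\<close>
    unfolding density_gf_below[OF assms \<open>k < c\<close>] series_coeffs_monomial3_times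
    by (simp add: series_coeffs_def)
next
  fix i j k :: int
  let ?N = "numer r s t \<alpha> (mu r s t a b c)"
  \<comment> \<open>Multiplication by \<open>D\<close> cancels \<open>inv_D\<close>, so the closed
    form has the same image under \<open>D\<close> as the density series.\<close>
  have "fps_to_fls (denomD r s t \<alpha>) * ?F =
      monomial3 a b c * fps_to_fls (denomD r s t \<alpha> * inv_D r s t \<alpha> * ?N)"
    by (simp only: fls_times_fps_to_fls mult_ac)
  also have "\<dots> = monomial3 a b c * fps_to_fls ?N"
    by (simp add: denomD_times_inv_D)
  finally have DF: "fps_to_fls (denomD r s t \<alpha>) * ?F = monomial3 a b c * fps_to_fls ?N" .
  show "density_gf r s t \<alpha> a b i j k + density_gf r s t \<alpha> a b i j (k - 2)
      - \<alpha> powi (r^2 - t^2) *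
          (density_gf r s t \<alpha> a b (i - 1) j (k - 1) + density_gf r s t \<alpha> a b (i + 1) j (k - 1))
      - \<alpha> powi (s^2 - t^2) *
          (density_gf r s t \<alpha> a b i (j - 1) (k - 1) + density_gf r s t \<alpha> a b i (j + 1) (k - 1)) =
      series_coeffs ?F i j k + series_coeffs ?F i j (k - 2)
      - \<alpha> powi (r^2 - t^2) *
          (series_coeffs ?F (i - 1) j (k - 1) + series_coeffs ?F (i + 1) j (k - 1))
      - \<alpha> powi (s^2 - t^2) *
          (series_coeffs ?F i (j - 1) (k - 1) + series_coeffs ?F i (j + 1) (k - 1))"
    unfolding density_gf_denomD[OF assms] DF[symmetric] series_coeffs_denomD_times ..
qed

theorem theorem3p3:
  fixes r s t i\<^sub>0 j\<^sub>0 k\<^sub>0 p :: int and \<alpha> :: real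
  assumes "0 \<le> r" "r < t" "0 \<le> s" "s < t"
    and "gcd r (gcd s t) = 1"
    and "\<alpha> > 1" "\<alpha> powi (t^2) = \<alpha> powi (r^2) + \<alpha> powi (s^2)"
    and "even (i\<^sub>0 + j\<^sub>0 + k\<^sub>0)"
    and "p = mu r s t i\<^sub>0 j\<^sub>0 k\<^sub>0" "p \<in> {0..2*t - 1}"
  shows "(r \<le> s \<longrightarrow> density_gf r s t \<alpha> i\<^sub>0 j\<^sub>0 =
            series_coeffs (monomial3 i\<^sub>0 j\<^sub>0 k\<^sub>0 * fps_to_fls (inv_D r s t \<alpha> * numer_le r s t \<alpha> p))) \<and>
         (s \<le> r \<longrightarrow> density_gf r s t \<alpha> i\<^sub>0 j\<^sub>0 =
            series_coeffs (monomial3 i\<^sub>0 j\<^sub>0 k\<^sub>0 * fps_to_fls (inv_D r s t \<alpha> * numer_ge r s t \<alpha> p)))"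
  using density_gf_eq[OF assms(1-4) _ assms(7,8)] assms(1,3,6,9,10)
  by (simp add: numer_le_eq_numer numer_ge_eq_numer)

end
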